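(* If $R$ is a left-total relation on a set $U$, then $\mathcal{RS}$ is order-isomorphic to $\prod_{C\in\mathfrak{Co}}\mathcal{RS}(C)$.
   Context: A binary relation $R$ on $U$ is left-total if for every $x\in U$ there is $y\in U$ with $x\,R\,y$. For $x\in U$, $R(x)=\{y\in U\mid x\,R\,y\}$. For $X\subseteq U$, $X^{\blacktriangledown}=\{x\in U\mid R(x)\subseteq X\}$ and $X^{\blacktriangle}=\{x\in U\mid R(x)\cap X\neq\emptyset\}$. The rough set of $X$ is $\mathcal{A}(X)=(X^{\blacktriangledown},X^{\blacktriangle})$, $RS=\{\mathcal{A}(X)\mid X\subseteq U\}$, and $\mathcal{RS}=(RS,\leq)$ with $\leq$ the coordinatewise inclusion order on pairs of sets. A connected component of $R$ is an equivalence class of the smallest equivalence relation on $U$ containing $R$; $\mathfrak{Co}$ is the set of all connected components. For $C\in\mathfrak{Co}$, $RS(C)$ is the set of rough sets on $C$ determined by the restriction $R_C=R\cap(C\times C)$ of $R$ to $C$, i.e. the set of all pairs $(\{x\in C\mid R_C(x)\subseteq X\},\{x\in C\mid R_C(x)\cap X\neq\emptyset\})$ with $X\subseteq C$, where $R_C(x)=\{y\in C\mid x\,R\,y\}$ for $x\in C$, and $\mathcal{RS}(C)$ is $RS(C)$ with the coordinatewise inclusion order. The product of partially ordered sets is the Cartesian product ordered coordinatewise. *)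

theory Defs
  imports Main "HOL-Library.FuncSet" "HOL-Library.Product_Order"
begin

definition left_total_on :: "'a set \<Rightarrow> 'a rel \<Rightarrow> bool" where
  "left_total_on U R \<longleftrightarrow> (\<forall>x\<in>U. \<exists>y\<in>U. (x, y) \<in> R)"

definition nbhd :: "'a set \<Rightarrow> 'a rel \<Rightarrow> 'a \<Rightarrow> 'a set" where
  "nbhd U R x = {y \<in> U. (x, y) \<in> R}"

definition lower_approx :: "'a set \<Rightarrow> 'a rel \<Rightarrow> 'a set \<Rightarrow> 'a set" where
  "lower_approx U R X = {x \<in> U. nbhd U R x \<subseteq> X}"

definition upper_approx :: "'a set \<Rightarrow> 'a rel \<Rightarrow> 'a set \<Rightarrow> 'a set" where
  "upper_approx U R X = {x \<in> U. nbhd U R x \<inter> X \<noteq> {}}"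

definition rough_set :: "'a set \<Rightarrow> 'a rel \<Rightarrow> 'a set \<Rightarrow> 'a set \<times> 'a set" where
  "rough_set U R X = (lower_approx U R X, upper_approx U R X)"

text \<open>Rough sets are ordered by \<open>\<le>\<close> on pairs of sets, which
  \<open>HOL-Library.Product_Order\<close> instantiates as coordinatewise inclusion.\<close>

definition RS :: "'a set \<Rightarrow> 'a rel \<Rightarrow> ('a set \<times> 'a set) set" where
  "RS U R = {rough_set U R X | X. X \<subseteq> U}"

text \<open>The smallest equivalence relation on \<open>U\<close> containing \<open>R\<close>, for \<open>R \<subseteq> U \<times> U\<close>;
  the family intersected is then nonempty because it contains \<open>U \<times> U\<close>.\<close>

definition equiv_gen :: "'a set \<Rightarrow> 'a rel \<Rightarrow> 'a rel" where
  "equiv_gen U R = \<Inter> {E. equiv U E \<and> R \<subseteq> E}"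

definition components :: "'a set \<Rightarrow> 'a rel \<Rightarrow> 'a set set" where
  "components U R = U // equiv_gen U R"

definition RS_component :: "'a rel \<Rightarrow> 'a set \<Rightarrow> ('a set \<times> 'a set) set" where
  "RS_component R C = RS C (R \<inter> C \<times> C)"

definition coordinatewise_le :: "'i set \<Rightarrow> ('i \<Rightarrow> 'b::ord) \<Rightarrow> ('i \<Rightarrow> 'b) \<Rightarrow> bool" where
  "coordinatewise_le I f g \<longleftrightarrow> (\<forall>i\<in>I. f i \<le> g i)"

definition order_isomorphic ::
    "'a set \<Rightarrow> ('a \<Rightarrow> 'a \<Rightarrow> bool) \<Rightarrow> 'b set \<Rightarrow> ('b \<Rightarrow> 'b \<Rightarrow> bool) \<Rightarrow> bool" where
  "order_isomorphic A leA B leB \<longleftrightarrow>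
     (\<exists>f. bij_betw f A B \<and> (\<forall>x\<in>A. \<forall>y\<in>A. leA x y \<longleftrightarrow> leB (f x) (f y)))"

end

theory Submission
  imports Defs
begin

text \<open>
  A related pair lies in a single connected component, so for \<open>x\<close> in a component \<open>C\<close> the
  \<open>R\<close>-neighbourhood of \<open>x\<close> is contained in \<open>C\<close>, and whether \<open>x\<close> belongs to an approximation
  of \<open>X\<close> depends only on \<open>X \<inter> C\<close>. Hence intersecting both coordinates of the rough set of \<open>X\<close>
  with \<open>C\<close> yields the rough set of \<open>X \<inter> C\<close> on \<open>C\<close> (\<open>restrict_rough_set\<close>), and the isomorphism
  sends a rough set to the family of these restrictions.

  The components cover \<open>U\<close>, so one pair is below another exactly if this holds on each component
  (\<open>le_iff_restrict_le\<close>); by antisymmetry the map is then injective as well. The components are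
  pairwise disjoint, so subsets chosen independently in each of them are the traces of their union;
  this makes the map surjective.
\<close>

definition restrict_pair :: "'a set \<times> 'a set \<Rightarrow> 'a set \<Rightarrow> 'a set \<times> 'a set" where
  "restrict_pair p C = (fst p \<inter> C, snd p \<inter> C)"

lemma equiv_equiv_gen:
  assumes "R \<subseteq> U \<times> U"
  shows "equiv U (equiv_gen U R)"
proof -
  \<comment> \<open>The total relation is a member of the intersected family, which keeps the intersection
    inside \<open>U \<times> U\<close>.\<close>
  have "equiv U (U \<times> U)"
    by (auto intro!: equivI refl_onI symI transI)
  with assms have "equiv_gen U R \<subseteq> U \<times> U"
    unfolding equiv_gen_def by blast
  moreover have "refl_on U (equiv_gen U R)"
    by (rule refl_onI) (auto simp: equiv_gen_def equiv_def refl_on_def)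
  moreover have "sym (equiv_gen U R)"
    by (rule symI) (auto simp: equiv_gen_def equiv_def dest: symD)
  moreover have "trans (equiv_gen U R)"
    by (rule transI) (auto simp: equiv_gen_def equiv_def intro: transD)
  ultimately show ?thesis
    by (rule equivI)
qed

lemma Union_components:
  "R \<subseteq> U \<times> U \<Longrightarrow> \<Union> (components U R) = U"
  unfolding components_def by (intro Union_quotient equiv_equiv_gen)

lemma components_disjoint:
  assumes "R \<subseteq> U \<times> U" "C \<in> components U R" "D \<in> components U R" "C \<noteq> D"
  shows "C \<inter> D = {}"
  using quotient_disj[OF equiv_equiv_gen[OF assms(1)]] assms(2-4)
  unfolding components_def by blast

lemma component_closed:
  assumes "R \<subseteq> U \<times> U" "C \<in> components U R" "x \<in> C" "(x, y) \<in> R"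
  shows "y \<in> C"
proof -
  have "(x, y) \<in> equiv_gen U R"
    using assms(4) by (auto simp: equiv_gen_def)
  then show ?thesis
    using in_quotient_imp_closed[OF equiv_equiv_gen[OF assms(1)]] assms(2,3)
    unfolding components_def by blast
qed

lemma nbhd_restrict:
  assumes "R \<subseteq> U \<times> U" "C \<in> components U R" "x \<in> C"
  shows "nbhd C (R \<inter> C \<times> C) x = nbhd U R x"
  using component_closed[OF assms] assms(1,3) by (auto simp: nbhd_def)

text \<open>Neighbourhoods of points of \<open>C\<close> stay inside \<open>C\<close>, so they cannot tell \<open>X\<close> from \<open>X \<inter> C\<close>.\<close>

lemma restrict_rough_set:
  assumes "R \<subseteq> U \<times> U" "C \<in> components U R"
  shows "restrict_pair (rough_set U R X) C = rough_set C (R \<inter> C \<times> C) (X \<inter> C)"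
proof -
  have CU: "C \<subseteq> U"
    using Union_components[OF assms(1)] assms(2) by blast
  have nb: "nbhd C (R \<inter> C \<times> C) x = nbhd U R x" "nbhd U R x \<subseteq> C" if "x \<in> C" for x
    using nbhd_restrict[OF assms that] by (auto simp: nbhd_def)
  have "lower_approx U R X \<inter> C = lower_approx C (R \<inter> C \<times> C) (X \<inter> C)"
    using CU nb unfolding lower_approx_def by blast
  moreover have "upper_approx U R X \<inter> C = upper_approx C (R \<inter> C \<times> C) (X \<inter> C)"
    using CU nb unfolding upper_approx_def by blast
  ultimately show ?thesis
    by (simp add: restrict_pair_def rough_set_def)
qed

lemma le_iff_restrict_le:
  assumes "fst p \<subseteq> \<Union> \<C>" "snd p \<subseteq> \<Union> \<C>"
  shows "p \<le> q \<longleftrightarrow> (\<forall>C\<in>\<C>. restrict_pair p C \<le> restrict_pair q C)"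
  using assms unfolding restrict_pair_def less_eq_prod_def by auto blast+

theorem theorem2p4:
  fixes U :: "'a set" and R :: "'a rel"
  assumes "R \<subseteq> U \<times> U"
    and "left_total_on U R"
  shows "order_isomorphic (RS U R) (\<le>)
           (\<Pi>\<^sub>E C\<in>components U R. RS_component R C) (coordinatewise_le (components U R))"
proof -
  let ?Co = "components U R"
  let ?P = "\<Pi>\<^sub>E C\<in>?Co. RS_component R C"
  define \<phi> where "\<phi> p = restrict (restrict_pair p) ?Co" for p :: "'a set \<times> 'a set"
  have emb: "p \<le> q \<longleftrightarrow> coordinatewise_le ?Co (\<phi> p) (\<phi> q)" if "p \<in> RS U R" for p q
  proof -
    have "fst p \<subseteq> \<Union> ?Co" "snd p \<subseteq> \<Union> ?Co"
      using that Union_components[OF assms(1)]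
      by (auto simp: RS_def rough_set_def lower_approx_def upper_approx_def)
    then show ?thesis
      by (simp add: le_iff_restrict_le coordinatewise_le_def \<phi>_def)
  qed
  have "inj_on \<phi> (RS U R)"
  proof (rule inj_onI)
    fix p q assume "p \<in> RS U R" "q \<in> RS U R" "\<phi> p = \<phi> q"
    then have "p \<le> q" "q \<le> p"
      by (simp_all add: emb coordinatewise_le_def)
    then show "p = q"
      by (rule antisym)
  qed
  moreover have "\<phi> p \<in> ?P" if "p \<in> RS U R" for p
    using that restrict_rough_set[OF assms(1)]
    by (fastforce simp: RS_def RS_component_def \<phi>_def)
  moreover have "g \<in> \<phi> ` RS U R" if g: "g \<in> ?P" for g
  proof -
    have "\<forall>C\<in>?Co. \<exists>X\<subseteq>C. g C = rough_set C (R \<inter> C \<times> C) X"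
      using g by (auto simp: PiE_iff RS_component_def RS_def)
    then obtain X where X: "X C \<subseteq> C" "g C = rough_set C (R \<inter> C \<times> C) (X C)" if "C \<in> ?Co" for C
      by metis
    define Y where "Y = (\<Union>C\<in>?Co. X C)"
    have "Y \<subseteq> U"
      using X(1) Union_components[OF assms(1)] unfolding Y_def by blast
    have trace: "Y \<inter> C = X C" if "C \<in> ?Co" for C
      using X(1) components_disjoint[OF assms(1)] that unfolding Y_def by blast
    have "\<phi> (rough_set U R Y) = g"
    proof (rule extensionalityI)
      show "\<phi> (rough_set U R Y) \<in> extensional ?Co" "g \<in> extensional ?Co"
        using g by (auto simp: \<phi>_def PiE_iff)
      show "\<phi> (rough_set U R Y) C = g C" if "C \<in> ?Co" for C
        using that by (simp add: \<phi>_def restrict_rough_set[OF assms(1)] trace X(2))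
    qed
    with \<open>Y \<subseteq> U\<close> show ?thesis
      by (auto simp: RS_def)
  qed
  ultimately have "bij_betw \<phi> (RS U R) ?P"
    by (auto simp: bij_betw_def)
  with emb show ?thesis
    unfolding order_isomorphic_def by blast
qed

end
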